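(* Let $G$ be a graph of order $n$ such that there exists a unique $\gamma(G)$-set and $\gamma(G)=\beta(G)$. Then for any integer $t\ge 2$, $$\gamma(S(G,t))=n^{t-2}\bigl(n\gamma(G)-\xi(G)\bigr).$$
   Context: A set $D\subseteq V$ is dominating in $G=(V,E)$ if every vertex of $V\setminus D$ has a neighbour in $D$; the domination number $\gamma(G)$ is the minimum cardinality of a dominating set, and a dominating set of cardinality $\gamma(G)$ is a $\gamma(G)$-set. $\beta(G)$ is the vertex cover number (minimum cardinality of a set of vertices meeting every edge). Let $\mathcal D(G)$ be the set of all $\gamma(G)$-sets. Define $\xi(G)=\max_{D\in\mathcal D(G)}\{|D'|:\ D'\subseteq D \text{ and the subgraph induced by } D' \text{ has no isolated vertices}\}$ (the empty set is allowed). For a positive integer $t$, $V^t$ denotes the set of words $u=u_1\cdots u_t$ of length $t$ over $V$. The generalized Sierpiński graph $S(G,t)$ has vertex set $V^t$, and $\{u,v\}$ is an edge if and only if there is $i\in\{1,\dots,t\}$ such that: (i) $u_j=v_j$ for all $j<i$; (ii) $u_i\ne v_i$ and $\{u_i,v_i\}\in E$; (iii) $u_j=v_i$ and $v_j=u_i$ for all $j>i$. *)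

theory Defs
  imports "Graph_Theory.Graph_Theory"
begin

text \<open>
  A finite simple graph is a digraph satisfying the locale predicate \<^const>\<open>graph\<close>:
  finite, loop-free, symmetric and without parallel arcs. An undirected edge \<open>{u, v}\<close>
  is represented by the two arcs from \<open>u\<close> to \<open>v\<close> and from \<open>v\<close> to \<open>u\<close>.
\<close>

definition dominating_set :: "('a, 'b) pre_digraph \<Rightarrow> 'a set \<Rightarrow> bool" where
  "dominating_set G D \<longleftrightarrow>
     D \<subseteq> verts G \<and> (\<forall>v \<in> verts G - D. \<exists>u \<in> D. v \<rightarrow>\<^bsub>G\<^esub> u)"

definition domination_number :: "('a, 'b) pre_digraph \<Rightarrow> nat" where
  "domination_number G = Min (card ` {D. dominating_set G D})"

definition gamma_set :: "('a, 'b) pre_digraph \<Rightarrow> 'a set \<Rightarrow> bool" where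
  "gamma_set G D \<longleftrightarrow> dominating_set G D \<and> card D = domination_number G"

definition vertex_cover :: "('a, 'b) pre_digraph \<Rightarrow> 'a set \<Rightarrow> bool" where
  "vertex_cover G C \<longleftrightarrow>
     C \<subseteq> verts G \<and> (\<forall>u v. u \<rightarrow>\<^bsub>G\<^esub> v \<longrightarrow> u \<in> C \<or> v \<in> C)"

definition vertex_cover_number :: "('a, 'b) pre_digraph \<Rightarrow> nat" where
  "vertex_cover_number G = Min (card ` {C. vertex_cover G C})"

definition isolated_vertex :: "('a, 'b) pre_digraph \<Rightarrow> 'a \<Rightarrow> bool" where
  "isolated_vertex G v \<longleftrightarrow> v \<in> verts G \<and> \<not> (\<exists>u \<in> verts G. v \<rightarrow>\<^bsub>G\<^esub> u)"

definition xi :: "('a, 'b) pre_digraph \<Rightarrow> nat" where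
  "xi G = Max {card D' | D D'. gamma_set G D \<and> D' \<subseteq> D \<and>
                               (\<nexists>v. isolated_vertex (G \<restriction> D') v)}"

definition words :: "'a set \<Rightarrow> nat \<Rightarrow> 'a list set" where
  "words V t = {u. set u \<subseteq> V \<and> length u = t}"

text \<open>Positions in a word are counted from \<open>0\<close>, so the index \<open>i\<close> ranges over \<open>0, \<dots>, t - 1\<close>.\<close>

definition sierpinski_adj :: "('a, 'b) pre_digraph \<Rightarrow> nat \<Rightarrow> 'a list \<Rightarrow> 'a list \<Rightarrow> bool" where
  "sierpinski_adj G t u v \<longleftrightarrow>
     (\<exists>i < t. (\<forall>j < i. u ! j = v ! j) \<and>
              (u ! i \<noteq> v ! i \<and> u ! i \<rightarrow>\<^bsub>G\<^esub> v ! i) \<and>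
              (\<forall>j. i < j \<and> j < t \<longrightarrow> u ! j = v ! i \<and> v ! j = u ! i))"

definition sierpinski ::
    "('a, 'b) pre_digraph \<Rightarrow> nat \<Rightarrow> ('a list, 'a list \<times> 'a list) pre_digraph" where
  "sierpinski G t = with_proj
     \<lparr> pverts = words (verts G) t,
       parcs = {(u, v). u \<in> words (verts G) t \<and> v \<in> words (verts G) t \<and> sierpinski_adj G t u v} \<rparr>"

lemma graph_sierpinski:
  assumes "graph G"
  shows "graph (sierpinski G t)"
proof -
  interpret graph G by fact
  let ?V = "words (verts G) t"
  let ?E = "{(u, v). u \<in> ?V \<and> v \<in> ?V \<and> sierpinski_adj G t u v}"
  have fin: "finite ?V"
    unfolding words_def by (rule finite_lists_length_eq) simp
  have finE: "finite ?E"
    by (rule finite_subset[of _ "?V \<times> ?V"]) (use fin in auto)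
  have sym: "sierpinski_adj G t v u" if "sierpinski_adj G t u v" for u v
  proof -
    obtain i where "i < t" and *: "\<forall>j < i. u ! j = v ! j" "u ! i \<noteq> v ! i" "u ! i \<rightarrow>\<^bsub>G\<^esub> v ! i"
        "\<forall>j. i < j \<and> j < t \<longrightarrow> u ! j = v ! i \<and> v ! j = u ! i"
      using \<open>sierpinski_adj G t u v\<close> unfolding sierpinski_adj_def by blast
    have "v ! i \<rightarrow>\<^bsub>G\<^esub> u ! i"
      using *(3) by (rule graph_symmetric)
    with \<open>i < t\<close> * show ?thesis
      unfolding sierpinski_adj_def by (intro exI[of _ i]) auto
  qed
  have sym_arcs: "symmetric (with_proj \<lparr> pverts = ?V, parcs = ?E \<rparr>)"
    unfolding symmetric_def with_proj_simps by (rule symI) (simp add: sym)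
  have irrefl: "u \<noteq> v" if "sierpinski_adj G t u v" for u v
    using that unfolding sierpinski_adj_def by blast
  have loopfree: "fst e \<noteq> snd e" if "e \<in> ?E" for e
    using that irrefl[of "fst e" "snd e"] by (simp add: split_beta)
  have "pair_graph \<lparr> pverts = ?V, parcs = ?E \<rparr>"
    by unfold_locales (use fin finE sym_arcs loopfree in \<open>simp_all add: split_beta\<close>)
  then show ?thesis
    unfolding sierpinski_def by (rule pair_graph.pair_graphD_graph)
qed

end

theory Submission
  imports Defs
begin

text \<open>
  Slice a dominating set \<open>S\<close> of \<open>S(G,t)\<close> into the traces \<open>S\<^sub>w = {x. wx \<in> S}\<close> for the words \<open>w\<close> of length
  \<open>t - 1\<close>. Only vertices \<open>wx\<close> with \<open>x\<close> in the closed neighbourhood of the last letter \<open>y\<close> of \<open>w\<close> have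
  neighbours outside the copy \<open>wG\<close>, so \<open>S\<^sub>w \<union> {y}\<close> dominates \<open>G\<close> and \<open>|S\<^sub>w| \<ge> \<gamma> - 1\<close>. Let \<open>D\<close> be the
  unique \<open>\<gamma>\<close>-set. Equality forces \<open>S\<^sub>w = D - {y}\<close>. If moreover \<open>y\<close> has no neighbour in \<open>D\<close>, then \<open>wy\<close>
  must be dominated from outside, so \<open>w = p z y\<^sup>k\<close> and \<open>S\<close> contains \<open>p y z\<^sup>k z\<close>, where
  \<open>z \<notin> D\<close>; then \<open>p y z\<^sup>k\<close> has a trace that dominates \<open>G\<close> and differs from \<open>D\<close>, hence has at least
  \<open>\<gamma> + 1\<close> elements and pays for \<open>w\<close>. So the total saving is at most one for each \<open>w\<close> whose last letter
  is a non-isolated vertex of \<open>G[D]\<close>, and there are \<open>n\<^sup>t\<^sup>-\<^sup>2 \<xi>\<close> of these. Deleting the vertices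
  \<open>pyy\<close> with such \<open>y\<close> from the copies of \<open>D\<close> attains the bound.
\<close>

definition nonisolated :: "('a, 'b) pre_digraph \<Rightarrow> 'a set \<Rightarrow> 'a set" where
  "nonisolated G D = {v \<in> D. \<exists>u \<in> D. v \<rightarrow>\<^bsub>G\<^esub> u}"

lemma dominates_induce_subgraph_iff:
  "u \<rightarrow>\<^bsub>G \<restriction> A\<^esub> v \<longleftrightarrow> u \<in> A \<and> v \<in> A \<and> u \<rightarrow>\<^bsub>G\<^esub> v"
  by (auto simp: arcs_ends_def arc_to_ends_def image_iff)

section \<open>Words and edges of S(G,t)\<close>

lemma dominates_sierpinski_iff:
  "u \<rightarrow>\<^bsub>sierpinski G t\<^esub> v \<longleftrightarrow>
     u \<in> words (verts G) t \<and> v \<in> words (verts G) t \<and> sierpinski_adj G t u v"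
  by (simp add: sierpinski_def with_proj_simps)

lemma verts_sierpinski: "verts (sierpinski G t) = words (verts G) t"
  by (simp add: sierpinski_def)

lemma finite_words: "finite V \<Longrightarrow> finite (words V t)"
  unfolding words_def by (rule finite_lists_length_eq)

lemma card_words: "finite V \<Longrightarrow> card (words V t) = card V ^ t"
  unfolding words_def by (rule card_lists_length_eq)

lemma words_append_single: "w @ [x] \<in> words V (Suc r) \<longleftrightarrow> w \<in> words V r \<and> x \<in> V"
  by (auto simp: words_def)

lemma words_Suc_cases:
  assumes "u \<in> words V (Suc r)"
  obtains w x where "u = w @ [x]" "w \<in> words V r" "x \<in> V"
  using assms by (cases u rule: rev_cases) (auto simp: words_def)

text \<open>Writes an edge as common prefix, differing letter and constant tail, a form from which
  the last letter can be split off; here \<open>k = t - 1 - i\<close>.\<close>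

lemma sierpinski_adj_iff:
  assumes "length u = t" "length v = t"
  shows "sierpinski_adj G t u v \<longleftrightarrow>
    (\<exists>p a b k. u = p @ a # replicate k b \<and> v = p @ b # replicate k a \<and> a \<noteq> b \<and> a \<rightarrow>\<^bsub>G\<^esub> b)"
    (is "?L \<longleftrightarrow> ?R")
proof
  assume ?L
  then obtain i where i: "i < t" "\<forall>j<i. u ! j = v ! j" "u ! i \<noteq> v ! i" "u ! i \<rightarrow>\<^bsub>G\<^esub> v ! i"
    "\<forall>j. i < j \<and> j < t \<longrightarrow> u ! j = v ! i \<and> v ! j = u ! i"
    unfolding sierpinski_adj_def by blast
  have "drop (Suc i) u = replicate (t - Suc i) (v ! i)"
    "drop (Suc i) v = replicate (t - Suc i) (u ! i)"
    using i assms by (auto intro!: nth_equalityI)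
  moreover have "take i u = take i v"
    using i assms by (auto intro!: nth_equalityI)
  moreover have "u = take i u @ u ! i # drop (Suc i) u" "v = take i v @ v ! i # drop (Suc i) v"
    using i(1) assms by (auto intro: id_take_nth_drop)
  ultimately have "u = take i u @ u ! i # replicate (t - Suc i) (v ! i)"
    "v = take i u @ v ! i # replicate (t - Suc i) (u ! i)" by simp_all
  then show ?R
    using i(3,4) by blast
next
  assume ?R
  then obtain p a b k where "u = p @ a # replicate k b" "v = p @ b # replicate k a" "a \<noteq> b"
    "a \<rightarrow>\<^bsub>G\<^esub> b" by blast
  then show ?L
    using assms unfolding sierpinski_adj_def
    by (intro exI[of _ "length p"]) (auto simp: nth_append nth_Cons')
qed

text \<open>Relates the copies \<open>w\<close> and \<open>v\<close> that an edge leaving the vertex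
  \<open>w @ [last w]\<close> can join. The tail is nonempty so that the last letter of a word is
  its repeated letter.\<close>

definition swap_rel :: "'a list \<Rightarrow> 'a list \<Rightarrow> bool" where
  "swap_rel w v \<longleftrightarrow>
     (\<exists>p a b k. w = p @ a # replicate (Suc k) b \<and> v = p @ b # replicate (Suc k) a \<and> a \<noteq> b)"

lemma replicate_append_Cons_inject:
  assumes "replicate m y @ z # p = replicate m' y @ z' # p'" "z \<noteq> y" "z' \<noteq> y"
  shows "m = m' \<and> z = z' \<and> p = p'"
  using assms
proof (induction m arbitrary: m')
  case 0
  then show ?case by (cases m') auto
next
  case (Suc m)
  then show ?case by (cases m') auto
qed

text \<open>Read backwards, \<open>v\<close> starts with a maximal run of \<open>a\<close>; its
  length gives \<open>k\<close>, the letter that stops it is \<open>b\<close>, and the rest is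
  \<open>p\<close>.\<close>

lemma swap_rel_left_unique:
  assumes "swap_rel w v" "swap_rel w' v"
  shows "w = w'"
proof -
  obtain p a b k where 1: "w = p @ a # replicate (Suc k) b" "v = p @ b # replicate (Suc k) a" "a \<noteq> b"
    using assms(1) unfolding swap_rel_def by blast
  obtain p' a' b' k' where 2: "w' = p' @ a' # replicate (Suc k') b'"
    "v = p' @ b' # replicate (Suc k') a'" "a' \<noteq> b'"
    using assms(2) unfolding swap_rel_def by blast
  have "last v = a" using 1(2) by simp
  moreover have "last v = a'" using 2(2) by simp
  ultimately have aa: "a = a'" by simp
  have "rev v = replicate (Suc k) a @ b # rev p"
    unfolding 1(2) by (simp del: replicate_Suc)
  moreover have "rev v = replicate (Suc k') a @ b' # rev p'"
    unfolding 2(2) aa by (simp del: replicate_Suc)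
  ultimately have "Suc k = Suc k' \<and> b = b' \<and> rev p = rev p'"
    using 1(3) 2(3) aa by (intro replicate_append_Cons_inject[of "Suc k" a]) auto
  then show ?thesis using 1 2 aa by simp
qed

text \<open>If \<open>k = 0\<close>, the edge changes only the last letter and stays in the copy of
  \<open>w\<close>. If \<open>k > 0\<close>, then \<open>x\<close> ends the tail and the other
  \<open>m = k - 1\<close> tail letters end \<open>w\<close>; the final \<open>@ [a]\<close>
  separates the neighbouring copy from the letter inside it.\<close>

lemma sierpinski_neighbour_cases:
  assumes "(w @ [x]) \<rightarrow>\<^bsub>sierpinski G t\<^esub> v"
  obtains (inner) b where "v = w @ [b]" "x \<rightarrow>\<^bsub>G\<^esub> b"
  | (outer) p a m where "w = p @ a # replicate m x" "v = p @ x # replicate m a @ [a]"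
      "a \<noteq> x" "a \<rightarrow>\<^bsub>G\<^esub> x"
proof -
  have "length (w @ [x]) = t" "length v = t" "sierpinski_adj G t (w @ [x]) v"
    using assms by (auto simp: dominates_sierpinski_iff words_def)
  then obtain p a b k where *: "w @ [x] = p @ a # replicate k b" "v = p @ b # replicate k a" "a \<noteq> b"
    "a \<rightarrow>\<^bsub>G\<^esub> b"
    using sierpinski_adj_iff by blast
  show thesis
  proof (cases k)
    case 0
    then show thesis using * inner by auto
  next
    case (Suc m)
    then have "w @ [x] = (p @ a # replicate m b) @ [b]"
      using *(1) by (simp add: replicate_append_same)
    then have "w = p @ a # replicate m b" "x = b" by blast+
    then show thesis
      using * Suc outer by (simp add: replicate_append_same)
  qed
qed

section \<open>Minimum dominating sets\<close>

context fin_digraph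
begin

lemma finite_dominating_sets: "finite {D. dominating_set G D}"
  by (rule finite_subset[of _ "Pow (verts G)"]) (auto simp: dominating_set_def)

lemma dominating_set_finite: "dominating_set G D \<Longrightarrow> finite D"
  by (auto simp: dominating_set_def intro: finite_subset)

lemma domination_number_le: "dominating_set G D \<Longrightarrow> domination_number G \<le> card D"
  unfolding domination_number_def by (intro Min_le) (auto intro: finite_dominating_sets)

lemma ex_gamma_set: "\<exists>D. gamma_set G D"
proof -
  have "dominating_set G (verts G)" by (auto simp: dominating_set_def)
  then have "domination_number G \<in> card ` {D. dominating_set G D}"
    unfolding domination_number_def by (intro Min_in) (auto intro: finite_dominating_sets)
  then show ?thesis by (auto simp: gamma_set_def)
qed

end

section \<open>The value of \<xi> for a unique \<gamma>-set\<close>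

context graph
begin

text \<open>Every admissible \<open>D'\<close> lies in \<open>nonisolated G D\<close>. That set is
  itself admissible: by symmetry, a neighbour witnessing membership is a member too.\<close>

lemma xi_eq_card_nonisolated:
  assumes "finite D" "gamma_set G D" "\<And>E. gamma_set G E \<Longrightarrow> E = D"
  shows "xi G = card (nonisolated G D)"
proof -
  let ?M = "{card D' | D D'. gamma_set G D \<and> D' \<subseteq> D \<and> (\<nexists>v. isolated_vertex (G \<restriction> D') v)}"
  have bound: "k \<le> card (nonisolated G D)" if k: "k \<in> ?M" for k
  proof -
    obtain D' where D': "k = card D'" "D' \<subseteq> D" "\<nexists>v. isolated_vertex (G \<restriction> D') v"
      using k assms(3) by blast
    have "D' \<subseteq> nonisolated G D"
      using D'(2,3) by (fastforce simp: isolated_vertex_def nonisolated_def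
          dominates_induce_subgraph_iff)
    then show ?thesis
      using D'(1) assms(1) by (auto simp: nonisolated_def intro: card_mono)
  qed
  moreover have "card (nonisolated G D) \<in> ?M"
  proof -
    have "\<nexists>v. isolated_vertex (G \<restriction> nonisolated G D) v"
      using graph_symmetric
      by (force simp: isolated_vertex_def nonisolated_def dominates_induce_subgraph_iff)
    moreover have "nonisolated G D \<subseteq> D" by (auto simp: nonisolated_def)
    ultimately show ?thesis using assms(2) by blast
  qed
  moreover have "finite ?M"
    by (rule finite_subset[of _ "{..card (nonisolated G D)}"]) (use bound in auto)
  ultimately show ?thesis
    unfolding xi_def by (intro Max_eqI) auto
qed

section \<open>Upper bound: an explicit dominating set\<close>

lemma domination_number_sierpinski_le:
  assumes D: "gamma_set G D"
  shows "domination_number (sierpinski G (Suc (Suc s))) \<le>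
    card (verts G) ^ s * (card (verts G) * domination_number G - card (nonisolated G D))"
proof -
  let ?V = "verts G" and ?N = "nonisolated G D"
  \<comment> \<open>\<open>P\<close> holds the last two letters \<open>(y, x)\<close> of the chosen
    words: every copy keeps \<open>D\<close>, except that \<open>x = y\<close> is dropped for
    nonisolated \<open>y\<close>.\<close>
  define P where "P = ?V \<times> D - (\<lambda>x. (x, x)) ` ?N"
  define X where "X = (\<lambda>(p, y, x). p @ [y, x]) ` (words ?V s \<times> P)"
  interpret S: fin_digraph "sierpinski G (Suc (Suc s))"
    using graph_sierpinski[OF graph_axioms] by (simp add: graph_def digraph_def)
  have dom: "D \<subseteq> ?V" "\<And>v. v \<in> ?V \<Longrightarrow> v \<notin> D \<Longrightarrow> \<exists>u\<in>D. v \<rightarrow> u"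
    and card_D: "card D = domination_number G"
    using D by (auto simp: gamma_set_def dominating_set_def)
  have ND: "?N \<subseteq> D" by (auto simp: nonisolated_def)
  have inX: "p @ [y, x] \<in> X" if "p \<in> words ?V s" "y \<in> ?V" "x \<in> D" "x \<noteq> y \<or> x \<notin> ?N" for p x y
    using that unfolding X_def P_def by force
  have adjI: "(q @ a # replicate k b) \<rightarrow>\<^bsub>sierpinski G (Suc (Suc s))\<^esub> (q @ b # replicate k a)"
    if "q @ a # replicate k b \<in> words ?V (Suc (Suc s))" "a \<rightarrow> b" for q a b k
  proof -
    have "a \<noteq> b" "b \<in> ?V" "a \<in> ?V" using that(2) adj_not_same adj_in_verts by blast+
    then show ?thesis
      using that by (auto simp: dominates_sierpinski_iff words_def sierpinski_adj_iff
          split: if_splits)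
  qed
  have "dominating_set (sierpinski G (Suc (Suc s))) X"
    unfolding dominating_set_def verts_sierpinski
  proof (intro conjI ballI)
    show "X \<subseteq> words ?V (Suc (Suc s))"
      using dom(1) by (auto simp: X_def P_def words_def)
  next
    fix u assume u: "u \<in> words ?V (Suc (Suc s)) - X"
    then obtain w x where "u = w @ [x]" "w \<in> words ?V (Suc s)" "x \<in> ?V"
      using words_Suc_cases by blast
    moreover from this(2) obtain p y where "w = p @ [y]" "p \<in> words ?V s" "y \<in> ?V"
      by (rule words_Suc_cases)
    ultimately have u_eq: "u = p @ [y, x]" and p: "p \<in> words ?V s" "y \<in> ?V" "x \<in> ?V"
      by simp_all
    have inner: "u \<rightarrow>\<^bsub>sierpinski G (Suc (Suc s))\<^esub> (p @ [y, z])" if "x \<rightarrow> z" for z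
      using adjI[of "p @ [y]" x 0 z] u u_eq that by simp
    show "\<exists>v\<in>X. u \<rightarrow>\<^bsub>sierpinski G (Suc (Suc s))\<^esub> v"
    proof (cases "x \<in> D")
      case True
      \<comment> \<open>Here \<open>u\<close> is a dropped vertex, dominated inside its copy by a
        neighbour \<open>z\<close> of \<open>y\<close> in \<open>D\<close>, which is kept since
        \<open>z \<noteq> y\<close>.\<close>
      then have "x = y" "x \<in> ?N" using inX[OF p(1,2)] u u_eq by auto
      then obtain z where "z \<in> D" "x \<rightarrow> z" by (auto simp: nonisolated_def)
      then show ?thesis
        using inX[OF p(1,2), of z] inner \<open>x = y\<close> adj_not_same by blast
    next
      case False
      then obtain z where z: "z \<in> D" "x \<rightarrow> z" using dom(2) p by blast
      show ?thesis
      proof (cases "z = y")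
        case True
        \<comment> \<open>The natural dominator \<open>p @ [y, y]\<close> may have been dropped; the
          edge into the copy of \<open>p @ [x]\<close> replaces it, as
          \<open>x \<noteq> y\<close>.\<close>
        then have "p @ [x, y] \<in> X" using inX[OF p(1), of x y] p(3) z False by blast
        moreover have "u \<rightarrow>\<^bsub>sierpinski G (Suc (Suc s))\<^esub> (p @ [x, y])"
          using adjI[of p y 1 x] u u_eq z True graph_symmetric by simp
        ultimately show ?thesis by blast
      next
        case False
        then show ?thesis using inX[OF p(1,2), of z] inner z by blast
      qed
    qed
  qed
  then have "domination_number (sierpinski G (Suc (Suc s))) \<le> card X"
    by (rule S.domination_number_le)
  also have "card X = card (words ?V s \<times> P)"
    unfolding X_def by (rule card_image) (auto simp: inj_on_def)
  also have "\<dots> = card ?V ^ s * card P"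
    by (simp add: card_cartesian_product card_words)
  also have "card P = card ?V * domination_number G - card ?N"
    unfolding P_def using ND dom(1) finite_subset[OF dom(1)] finite_subset[OF ND] card_D
    by (subst card_Diff_subset) (auto simp: card_cartesian_product card_image inj_on_def)
  finally show ?thesis .
qed

lemma card_nonisolated_le:
  assumes "gamma_set G D"
  shows "card (nonisolated G D) \<le> card (verts G) * domination_number G"
proof -
  have D: "D \<subseteq> verts G" "card D = domination_number G"
    using assms by (auto simp: gamma_set_def dominating_set_def)
  then have "finite D" by (auto intro: finite_subset)
  then have "card (nonisolated G D) \<le> card D"
    by (auto simp: nonisolated_def intro: card_mono)
  also have "\<dots> \<le> card (verts G) * card D"
    using D(1) by (cases "D = {}") (auto simp: card_gt_0_iff Suc_le_eq)
  finally show ?thesis using D(2) by simp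
qed

section \<open>Lower bound: traces and compensation\<close>

lemma sierpinski_trace_dominating:
  assumes S: "dominating_set (sierpinski G (Suc r)) S"
    and w: "w \<in> words (verts G) r" "w \<noteq> []"
  shows "dominating_set G (insert (last w) {x \<in> verts G. w @ [x] \<in> S})"
    (is "dominating_set G (insert _ ?T)")
  unfolding dominating_set_def
proof (intro conjI ballI)
  show "insert (last w) ?T \<subseteq> verts G"
    using w by (auto simp: words_def)
next
  fix x assume x: "x \<in> verts G - insert (last w) ?T"
  then have "w @ [x] \<in> words (verts G) (Suc r) - S"
    using w by (auto simp: words_append_single)
  then obtain v where v: "v \<in> S" "(w @ [x]) \<rightarrow>\<^bsub>sierpinski G (Suc r)\<^esub> v"
    using S by (auto simp: dominating_set_def verts_sierpinski)
  from v(2) show "\<exists>u\<in>insert (last w) ?T. x \<rightarrow> u"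
  proof (cases rule: sierpinski_neighbour_cases)
    case (inner b)
    then show ?thesis using v(1) adj_in_verts by blast
  next
    case (outer p a m)
    \<comment> \<open>For \<open>m = 0\<close>, the last letter of \<open>w\<close> is
      \<open>a\<close>, a neighbour of \<open>x\<close>; for \<open>m > 0\<close> it is
      \<open>x\<close> itself, which was excluded.\<close>
    then show ?thesis
      using x graph_symmetric by (cases m) auto
  qed
qed

lemma domination_number_sierpinski_ge:
  assumes D: "gamma_set G D" and uniq: "\<And>E. gamma_set G E \<Longrightarrow> E = D"
    and S: "dominating_set (sierpinski G (Suc (Suc s))) S"
  shows "card (verts G) ^ Suc s * domination_number G \<le>
    card S + card (verts G) ^ s * card (nonisolated G D)"
proof -
  let ?V = "verts G" and ?N = "nonisolated G D" and ?g = "domination_number G"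
  let ?W = "words ?V (Suc s)"
  define T where "T w = {x \<in> ?V. w @ [x] \<in> S}" for w
  have finT: "finite (T w)" for w by (simp add: T_def)
  have finW: "finite ?W" by (simp add: finite_words)
  have dom: "dominating_set G (insert (last w) (T w))" if "w \<in> ?W" for w
    unfolding T_def by (rule sierpinski_trace_dominating[OF S that]) (use that in \<open>auto simp: words_def\<close>)
  have ge: "?g \<le> Suc (card (T w))" if "w \<in> ?W" for w
    using domination_number_le[OF dom[OF that]] card_insert_le_m1[of "Suc (card (T w))" "T w" "last w"]
    by simp
  \<comment> \<open>The deficits in \<open>A\<close> are counted by \<open>nonisolated G D\<close>;
    each one in \<open>B\<close> must be offset by a surplus in another copy.\<close>
  define A where "A = {w \<in> ?W. last w \<in> ?N}"
  define B where "B = {w \<in> ?W. last w \<notin> ?N \<and> card (T w) < ?g}"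
  have partner: "\<exists>v\<in>?W. swap_rel w v \<and> ?g < card (T v)" if "w \<in> B" for w
  proof -
    let ?y = "last w"
    have w: "w \<in> ?W" "?y \<notin> ?N" "card (T w) < ?g" using that by (auto simp: B_def)
    have y: "?y \<in> ?V" using dom[OF w(1)] by (simp add: dominating_set_def)
    \<comment> \<open>Otherwise \<open>T w\<close> alone would dominate with fewer than
      \<open>?g\<close> vertices.\<close>
    have notin: "?y \<notin> T w"
      using domination_number_le[OF dom[OF w(1)]] w(3) by (auto simp: insert_absorb)
    then have "card (insert ?y (T w)) = ?g"
      using domination_number_le[OF dom[OF w(1)]] w(3) finT by simp
    then have D_eq: "insert ?y (T w) = D"
      using uniq dom[OF w(1)] by (simp add: gamma_set_def)
    have iso: "\<not> ?y \<rightarrow> u" if "u \<in> D" for u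
      using that w(2) D_eq by (auto simp: nonisolated_def)
    have "w @ [?y] \<in> words ?V (Suc (Suc s)) - S"
      using w(1) y notin by (auto simp: words_append_single T_def)
    then obtain v where v: "v \<in> S" "(w @ [?y]) \<rightarrow>\<^bsub>sierpinski G (Suc (Suc s))\<^esub> v"
      using S by (auto simp: dominating_set_def verts_sierpinski)
    from v(2) show ?thesis
    proof (cases rule: sierpinski_neighbour_cases)
      case (inner b)
      then have "b \<in> T w" using v(1) adj_in_verts by (auto simp: T_def)
      then show ?thesis using iso D_eq inner by blast
    next
      case (outer p a m)
      \<comment> \<open>This makes \<open>a\<close> the last letter of \<open>q\<close> below, so
        that the trace of \<open>q\<close> dominates without an added vertex.\<close>
      have "m \<noteq> 0"
      proof
        assume "m = 0"
        then have "last w = a" using outer(1) by (metis last_snoc replicate_0)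
        then show False using outer(3) by simp
      qed
      then obtain k where m: "m = Suc k" by (cases m) auto
      define q where "q = p @ ?y # replicate m a"
      have "a \<in> ?V" using outer(4) adj_in_verts by blast
      have "w = p @ a # replicate (Suc k) ?y" "q = p @ ?y # replicate (Suc k) a"
        using outer(1) by (simp_all only: q_def m)
      then have swap: "swap_rel w q"
        unfolding swap_rel_def using outer(3) by blast
      have "v = q @ [a]" using outer(2) by (simp add: q_def)
      then have q: "q \<in> ?W" "a \<in> T q"
        using v \<open>a \<in> ?V\<close> by (auto simp: dominates_sierpinski_iff words_append_single T_def)
      have "last q = a" by (simp add: q_def m)
      then have domq: "dominating_set G (T q)"
        using dom[OF q(1)] q(2) by (simp add: insert_absorb)
      \<comment> \<open>\<open>a\<close> is a neighbour of \<open>?y\<close>, which has none in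
        \<open>D\<close>. So \<open>T q\<close> is a dominating set other than \<open>D\<close>, and
        uniqueness excludes size \<open>?g\<close>.\<close>
      have "a \<notin> D" using iso outer(4) graph_symmetric by blast
      then have "T q \<noteq> D" using q(2) by blast
      then have "card (T q) \<noteq> ?g" using uniq domq by (auto simp: gamma_set_def)
      then have "?g < card (T q)" using domination_number_le[OF domq] by simp
      then show ?thesis using swap q(1) by blast
    qed
  qed
  have "\<forall>w\<in>B. \<exists>v. v \<in> ?W \<and> swap_rel w v \<and> ?g < card (T v)"
    using partner by blast
  then obtain f where f: "f w \<in> ?W" "swap_rel w (f w)" "?g < card (T (f w))" if "w \<in> B" for w
    using bchoice by metis
  \<comment> \<open>Distinct deficient copies are paid for by distinct surplus copies.\<close>
  have inj: "inj_on f B"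
    by (rule inj_onI) (metis f(2) swap_rel_left_unique)
  define C where "C = f ` B"
  have C: "C \<subseteq> ?W" "\<And>v. v \<in> C \<Longrightarrow> ?g < card (T v)"
    using f by (auto simp: C_def)
  have AB: "A \<subseteq> ?W" "B \<subseteq> ?W" by (auto simp: A_def B_def)
  have cardC: "card C = card B" unfolding C_def by (rule card_image[OF inj])
  have card_A: "card A = card ?V ^ s * card ?N"
  proof -
    have "?N \<subseteq> ?V" using D by (auto simp: nonisolated_def gamma_set_def dominating_set_def)
    then have "A = (\<lambda>(p, y). p @ [y]) ` (words ?V s \<times> ?N)"
      unfolding A_def by (auto simp: words_append_single image_iff elim!: words_Suc_cases)
    moreover have "inj_on (\<lambda>(p, y). p @ [y]) (words ?V s \<times> ?N)" by (auto simp: inj_on_def)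
    ultimately show ?thesis
      by (simp add: card_image card_cartesian_product card_words)
  qed
  have card_S: "card S = (\<Sum>w\<in>?W. card (T w))"
  proof -
    have "S \<subseteq> words ?V (Suc (Suc s))"
      using S by (simp add: dominating_set_def verts_sierpinski)
    then have "S = (\<lambda>(w, x). w @ [x]) ` Sigma ?W T"
      unfolding T_def by (force simp: words_append_single elim: words_Suc_cases)
    moreover have "inj_on (\<lambda>(w, x). w @ [x]) (Sigma ?W T)" by (auto simp: inj_on_def)
    ultimately have "card S = card (Sigma ?W T)" by (simp add: card_image)
    then show ?thesis using finW finT by simp
  qed
  \<comment> \<open>A copy in \<open>C\<close> has a surplus of at least one; elsewhere the deficit
    is at most one and occurs only in \<open>A\<close> or \<open>B\<close>.\<close>
  have pw: "?g + of_bool (w \<in> C) \<le> card (T w) + of_bool (w \<in> A) + of_bool (w \<in> B)"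
    if "w \<in> ?W" for w
    using that ge[OF that] C(2)[of w] by (auto simp: A_def B_def)
  have ind: "(\<Sum>w\<in>?W. of_bool (w \<in> E)) = card E" if "E \<subseteq> ?W" for E
    using that finW by (simp add: of_bool_def sum.If_cases Int_absorb1)
  have "(\<Sum>w\<in>?W. ?g + of_bool (w \<in> C)) \<le> (\<Sum>w\<in>?W. card (T w) + of_bool (w \<in> A) + of_bool (w \<in> B))"
    by (rule sum_mono) (rule pw)
  then have "card ?W * ?g + card C \<le> card S + card A + card B"
    using C(1) AB by (simp add: sum.distrib ind card_S del: sum_of_bool_eq)
  \<comment> \<open>\<open>card C = card B\<close> cancels, leaving only \<open>card A\<close> as
    possible saving.\<close>
  then show ?thesis
    by (simp add: cardC card_A card_words)
qed

end

theorem theorem13: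
  fixes G :: "('a, 'b) pre_digraph" and n t :: nat
  assumes "graph G"
    and "card (verts G) = n"
    and "\<exists>!D. gamma_set G D"
    and "domination_number G = vertex_cover_number G"
    and "t \<ge> 2"
  shows "int (domination_number (sierpinski G t)) =
           int n ^ (t - 2) * (int n * int (domination_number G) - int (xi G))"
proof -
  interpret graph G by fact
  obtain D where D: "gamma_set G D" "\<And>E. gamma_set G E \<Longrightarrow> E = D"
    using assms(3) by blast
  have "finite D" using D(1) dominating_set_finite by (simp add: gamma_set_def)
  then have xi: "xi G = card (nonisolated G D)"
    using D by (rule xi_eq_card_nonisolated)
  obtain s where t: "t = Suc (Suc s)"
    using assms(5) by (metis add_2_eq_Suc le_Suc_ex)
  interpret S: fin_digraph "sierpinski G t"
    using graph_sierpinski[OF assms(1)] by (simp add: graph_def digraph_def)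
  obtain X where X: "gamma_set (sierpinski G t) X"
    using S.ex_gamma_set by blast
  let ?g = "domination_number G"
  \<comment> \<open>Lets the natural-number difference in the bounds be read as the integer
    difference of the conclusion.\<close>
  have le: "xi G \<le> n * ?g"
    using card_nonisolated_le[OF D(1)] assms(2) xi by simp
  have "domination_number (sierpinski G t) \<le> n ^ s * (n * ?g - xi G)"
    using domination_number_sierpinski_le[OF D(1), of s] assms(2) xi t by simp
  moreover have "n ^ Suc s * ?g \<le> domination_number (sierpinski G t) + n ^ s * xi G"
    using domination_number_sierpinski_ge[OF D, of s X] X assms(2) xi t
    by (simp add: gamma_set_def)
  then have "n ^ s * (n * ?g - xi G) \<le> domination_number (sierpinski G t)"
    by (simp add: diff_mult_distrib2 algebra_simps)
  ultimately have "domination_number (sierpinski G t) = n ^ s * (n * ?g - xi G)"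
    by (rule antisym)
  then show ?thesis
    using le t by (simp add: of_nat_diff)
qed

end
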